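(* For all $n \in \mathbf{N}$ and all integers $r \geq 2$, the numbers $F_r(n)$ are equal: \[ F_2(n) = F_3(n) = F_4(n) = \cdots . \] Moreover, this common value equals the number of integer partitions of $n$ in which the part $1$ may appear in $3$ colors, while every other positive integer may appear in $2$ colors as a part.
   Context: $\mathbf{N}$ is the set of nonnegative integers. A partition of $n$ is a non-increasing finite sequence of positive integers (its parts) with sum $n$; the empty partition is the only partition of $0$. A $3$-colored partition is a partition in which each part carries one of three colors, black, red or green; it is considered as a finite multiset of colored parts (for example, there are nine $3$-colored partitions of $2$: $2_b, 2_r, 2_g, 1_b+1_b, 1_b+1_r, 1_b+1_g, 1_r+1_g, 1_r+1_r, 1_g+1_g$). Its weight is the sum of all its parts. For a $3$-colored partition $\lambda$, let $\lambda_b,\lambda_r,\lambda_g$ denote the ordinary partitions formed by its black, red and green parts respectively, and let $\ell_b,\ell_r,\ell_g$ be their numbers of parts. Let $k$ be the smallest black part of $\lambda$ (if it exists), and, when $\ell_r\ge k$, let $i_k$ be the $k$-th smallest red part of $\lambda$ (counted with multiplicity). Let $\#\{1_g\}$ be the number of green parts equal to $1$. For $r\ge 2$, $\mathcal{B}_{r,r}(n)$ is the set of partitions $(\lambda_1\ge\dots\ge\lambda_s)$ of $n$ such that $\lambda_j-\lambda_{j+r-1}\ge 2$ for all $j$ with $1\le j\le s-r+1$, and at most $r-1$ parts are equal to $1$ (the empty partition belongs to $\mathcal{B}_{r,r}(0)$). For $r\geq 2$, $\mathcal{F}_r$ is the set of $3$-colored partitions $\lambda$ such that $\lambda_g\in\mathcal{B}_{r,r}(n)$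 for some $n$, and such that one of the following holds: 1. $\lambda=\emptyset$; or $\lambda$ has only one color; or $\lambda$ has exactly two colors, one of which is green. 2. $\lambda$ has exactly two colors, black and red, and either (a) $\ell_r\le k-1$, or (b) $\ell_r\ge k$ and $k+i_k\ge r$. 3. $\lambda$ has exactly three colors, and either (a) $\ell_r\le k-1$, or (b) $\ell_r\ge k$, $k+i_k\ge r$ and $\ell_g-\#\{1_g\}<k+i_k-r+1$. $\mathcal{F}_r(n)$ is the set of elements of $\mathcal{F}_r$ of weight $n$, and $F_r(n)$ is its cardinality. *)

theory Defs
  imports Complex_Main "HOL-Library.Multiset"
begin

datatype color = Black | Red | Green

text \<open>A colored part is a pair (part, color).\<close>

definition weight :: "(nat \<times> color) multiset \<Rightarrow> nat" where
  "weight L = (\<Sum>p\<in>#L. fst p)"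

text \<open>Colored partitions of \<open>n\<close> in which a part \<open>p\<close> may carry the colors in \<open>A p\<close>.\<close>

definition colored_partitions :: "(nat \<Rightarrow> color set) \<Rightarrow> nat \<Rightarrow> (nat \<times> color) multiset set" where
  "colored_partitions A n =
     {L. (\<forall>p\<in>#L. fst p > 0 \<and> snd p \<in> A (fst p)) \<and> weight L = n}"

definition three_colored_partitions :: "nat \<Rightarrow> (nat \<times> color) multiset set" where
  "three_colored_partitions n = colored_partitions (\<lambda>_. UNIV) n"

lemma finite_colored_partitions: "finite (colored_partitions A n)"
proof -
  have "colored_partitions A n \<subseteq>
      mset ` {xs. set xs \<subseteq> {0..n} \<times> {Black, Red, Green} \<and> length xs \<le> n}"
  proof
    fix L assume "L \<in> colored_partitions A n"
    then have pos: "\<And>p. p \<in># L \<Longrightarrow> fst p > 0" and w: "weight L = n"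
      by (auto simp: colored_partitions_def)
    obtain xs where xs: "mset xs = L" using ex_mset by blast
    have le: "fst p \<le> n" if "p \<in># L" for p
      using multi_member_split[OF that] w by (auto simp: weight_def)
    have *: "size M \<le> (\<Sum>p\<in>#M. fst p)" if "\<And>p. p \<in># M \<Longrightarrow> fst p > 0"
      for M :: "(nat \<times> color) multiset"
      using that
    proof (induction M)
      case (add x M)
      then have "size M \<le> (\<Sum>p\<in>#M. fst p)" "fst x > 0" by auto
      then show ?case by simp
    qed simp
    have "size L \<le> n" using *[of L] pos w by (simp add: weight_def)
    then have "length xs \<le> n" using xs by auto
    moreover have "set xs \<subseteq> {0..n} \<times> {Black, Red, Green}"
    proof
      fix p assume "p \<in> set xs"
      then have "fst p \<le> n" using le[of p] xs by auto
      then show "p \<in> {0..n} \<times> {Black, Red, Green}"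
        by (cases p; cases "snd p") auto
    qed
    ultimately show "L \<in> mset ` {xs. set xs \<subseteq> {0..n} \<times> {Black, Red, Green} \<and> length xs \<le> n}"
      using xs by blast
  qed
  then show ?thesis
    by (rule finite_subset) (intro finite_imageI finite_lists_length_le, simp)
qed

definition parts_of_color :: "color \<Rightarrow> (nat \<times> color) multiset \<Rightarrow> nat multiset" where
  "parts_of_color c L = image_mset fst (filter_mset (\<lambda>p. snd p = c) L)"

definition colors :: "(nat \<times> color) multiset \<Rightarrow> color set" where
  "colors L = snd ` set_mset L"

definition num_parts :: "color \<Rightarrow> (nat \<times> color) multiset \<Rightarrow> nat" where
  "num_parts c L = size (parts_of_color c L)"

text \<open>Only meaningful if \<open>L\<close> has a black part.\<close>

definition smallest_black :: "(nat \<times> color) multiset \<Rightarrow> nat" where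
  "smallest_black L = Min (set_mset (parts_of_color Black L))"

text \<open>The \<open>k\<close>-th smallest red part, counted with multiplicity and starting from \<open>k = 1\<close>;
  only meaningful for \<open>1 \<le> k \<le> num_parts Red L\<close>.\<close>

definition kth_smallest_red :: "(nat \<times> color) multiset \<Rightarrow> nat \<Rightarrow> nat" where
  "kth_smallest_red L k = sorted_list_of_multiset (parts_of_color Red L) ! (k - 1)"

text \<open>The set \<open>\<B>\<^bsub>r,r\<^esub>(n)\<close>, as non-increasing lists with indices starting at \<open>0\<close>. The difference
  condition is written additively, since subtraction on the natural numbers truncates.\<close>

definition B_rr :: "nat \<Rightarrow> nat \<Rightarrow> nat list set" where
  "B_rr r n = {xs. sorted_wrt (\<ge>) xs \<and> (\<forall>x\<in>set xs. x > 0) \<and> sum_list xs = n \<and>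
     (\<forall>j. j + (r - 1) < length xs \<longrightarrow> xs ! j \<ge> xs ! (j + (r - 1)) + 2) \<and>
     count_list xs 1 \<le> r - 1}"

definition F_cond :: "nat \<Rightarrow> (nat \<times> color) multiset \<Rightarrow> bool" where
  "F_cond r L \<longleftrightarrow>
    (let k = smallest_black L; i\<^sub>k = kth_smallest_red L k;
         l\<^sub>r = num_parts Red L; l\<^sub>g = num_parts Green L;
         ones\<^sub>g = count (parts_of_color Green L) 1
     in (L = {#} \<or> card (colors L) = 1 \<or> (card (colors L) = 2 \<and> Green \<in> colors L))
      \<or> (colors L = {Black, Red} \<and>
           (l\<^sub>r \<le> k - 1 \<or> (l\<^sub>r \<ge> k \<and> k + i\<^sub>k \<ge> r)))
      \<or> (card (colors L) = 3 \<and>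
           (l\<^sub>r \<le> k - 1 \<or>
            (l\<^sub>r \<ge> k \<and> k + i\<^sub>k \<ge> r \<and>
             int l\<^sub>g - int ones\<^sub>g < int k + int i\<^sub>k - int r + 1))))"

definition F_set :: "nat \<Rightarrow> nat \<Rightarrow> (nat \<times> color) multiset set" where
  "F_set r n = {L \<in> three_colored_partitions n.
     (\<exists>m. rev (sorted_list_of_multiset (parts_of_color Green L)) \<in> B_rr r m) \<and> F_cond r L}"

definition F :: "nat \<Rightarrow> nat \<Rightarrow> nat" where
  "F r n = card (F_set r n)"

definition one_three_others_two :: "nat \<Rightarrow> (nat \<times> color) multiset set" where
  "one_three_others_two n =
     colored_partitions (\<lambda>p. if p = 1 then {Black, Red, Green} else {Black, Red}) n"

end

theory Submission
  imports Defs "HOL-Computational_Algebra.Formal_Power_Series"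
begin

text \<open>
  Write \<open>j\<close> for the number of green parts larger than \<open>1\<close> and put \<open>m = r + j\<close>. With
  \<open>i\<^sub>k = \<infinity>\<close> whenever there are fewer than \<open>k\<close> red parts, or no black parts, all the cases in the
  definition of \<open>\<F>\<^sub>r\<close> collapse to the single inequality \<open>k + i\<^sub>k \<ge> m\<close> (lemma \<open>F_cond_merge\<close>). The
  black and red parts therefore interact with the green ones only through the number \<open>j\<close>, and
  two independent facts give the theorem. Let \<open>E m\<close> be the generating function of the partitions
  with all parts at least \<open>m\<close>, so that \<open>E (m + 1) = (1 - q\<^sup>m) E m\<close>.

  The first fact (\<open>gf_threshold\<close>) is that the pairs of a black and a red partition with
  \<open>k + i\<^sub>k \<ge> m\<close> have the generating function \<open>E 1 * E m / (1 - q)\<close>. For a fixed smallest black part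
  \<open>k\<close>, the condition says that at most \<open>k - 1\<close> red parts are at most \<open>m - k - 1\<close>. The red
  partitions of this kind are governed by a \<open>q\<close>-binomial recursion, which shows that their
  generating function times \<open>E k\<close> is \<open>E 1 * E (m - 1)\<close>. As the black partitions with smallest part
  \<open>k\<close> contribute \<open>q\<^sup>k * E k\<close>, the sum over \<open>k\<close> is geometric.

  The second fact (\<open>gf_gordon_large_parts\<close>) is that the pairs of a green partition and a
  partition \<open>B\<close> with all parts at least \<open>r + j\<close> are equinumerous with all partitions. If \<open>B\<close> has
  \<open>l\<close> parts, then it amounts to a weight \<open>l * (r + j)\<close> and a partition \<open>Z\<close> with parts at most
  \<open>l\<close>. Let the green partition have \<open>a\<close> ones. Add \<open>l\<close> to all its parts, and join the result with
  \<open>Z\<close> and with \<open>r - a\<close> further parts \<open>l\<close> (none if \<open>l = 0\<close>): the weight is right, and in the new partition \<open>l\<close> is the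
  largest index such that \<open>l\<close> and \<open>l + 1\<close> together occur at least \<open>r\<close> times. Each partition has
  exactly one such index, if it is taken to be \<open>0\<close> in the absence of a positive one, and the
  construction can be reversed.

  By the first fact, the generating function of \<open>F r\<close> is \<open>E 1 / (1 - q)\<close> times the sum of
  \<open>q\<^bsup>|G|\<^esup> E (r + j)\<close> over the green partitions \<open>G\<close>, and by the second this sum is \<open>E 1\<close>. The factors
  of \<open>E 1 * E 1 / (1 - q)\<close> account for two copies of every part and one more copy of the part \<open>1\<close>.
\<close>

section \<open>Weighted sets and their generating functions\<close>

definition graded_finite :: "'a set \<Rightarrow> ('a \<Rightarrow> nat) \<Rightarrow> bool" where
  "graded_finite A w \<longleftrightarrow> (\<forall>n. finite {x\<in>A. w x \<le> n})"

text \<open>A bijection or a decomposition that respects weights is an identity between such series, and an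
  identity that involves differences, such as the recursions below, can be used in the same way.
  The coefficients are meaningful only for sets with finitely many elements of each weight, hence
  the hypothesis \<open>graded_finite\<close>.\<close>
definition gf :: "'a set \<Rightarrow> ('a \<Rightarrow> nat) \<Rightarrow> int fps" where
  "gf A w = Abs_fps (\<lambda>n. int (card {x\<in>A. w x = n}))"

lemma gf_nth: "fps_nth (gf A w) n = int (card {x\<in>A. w x = n})"
  by (simp add: gf_def)

lemma graded_finiteD: "graded_finite A w \<Longrightarrow> finite {x\<in>A. w x = n}"
  unfolding graded_finite_def by (rule finite_subset[of _ "{x\<in>A. w x \<le> n}"]) auto

lemma graded_finite_mono:
  assumes "graded_finite B v" "A \<subseteq> B" "\<And>x. x \<in> A \<Longrightarrow> v x \<le> w x"
  shows "graded_finite A w"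
  unfolding graded_finite_def
proof
  fix n
  have "{x\<in>A. w x \<le> n} \<subseteq> {x\<in>B. v x \<le> n}" using assms(2,3) by (auto intro: order_trans)
  then show "finite {x\<in>A. w x \<le> n}"
    using assms(1) finite_subset unfolding graded_finite_def by blast
qed

lemma graded_finite_subset: "graded_finite B w \<Longrightarrow> A \<subseteq> B \<Longrightarrow> graded_finite A w"
  by (rule graded_finite_mono) auto

lemma graded_finite_Times:
  assumes "graded_finite A w" "graded_finite B v"
  shows "graded_finite (A \<times> B) (\<lambda>(x, y). w x + v y)"
  unfolding graded_finite_def
proof
  fix n
  have "{p \<in> A \<times> B. (case p of (x, y) \<Rightarrow> w x + v y) \<le> n} \<subseteq> {x\<in>A. w x \<le> n} \<times> {y\<in>B. v y \<le> n}"
    by auto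
  then show "finite {p \<in> A \<times> B. (case p of (x, y) \<Rightarrow> w x + v y) \<le> n}"
    using assms finite_subset unfolding graded_finite_def by blast
qed

lemma gf_shift:
  assumes h: "bij_betw h A B" and w: "\<And>x. x \<in> A \<Longrightarrow> v (h x) = d + w x"
  shows "gf B v = fps_X ^ d * gf A w"
proof (rule fps_ext)
  fix n
  have B: "B = h ` A" and inj: "inj_on h A" using h by (auto simp: bij_betw_def)
  have "{y\<in>B. v y = n} = h ` {x\<in>A. d + w x = n}" unfolding B using w by auto
  then have "card {y\<in>B. v y = n} = card {x\<in>A. d + w x = n}"
    by (simp add: card_image inj_on_subset[OF inj])
  moreover have "{x\<in>A. d + w x = n} = (if n < d then {} else {x\<in>A. w x = n - d})" by auto
  ultimately show "fps_nth (gf B v) n = fps_nth (fps_X ^ d * gf A w) n"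
    by (simp add: gf_nth fps_X_power_mult_nth)
qed

lemma gf_bij:
  assumes "bij_betw h A B" and "\<And>x. x \<in> A \<Longrightarrow> v (h x) = w x"
  shows "gf B v = gf A w"
  using gf_shift[of h A B v 0 w] assms by simp

lemma gf_Un:
  assumes "graded_finite A w" "graded_finite B w" "A \<inter> B = {}"
  shows "gf (A \<union> B) w = gf A w + gf B w"
proof (rule fps_ext)
  fix n
  have "{x \<in> A \<union> B. w x = n} = {x\<in>A. w x = n} \<union> {x\<in>B. w x = n}" by auto
  then show "fps_nth (gf (A \<union> B) w) n = fps_nth (gf A w + gf B w) n"
    using assms by (simp add: gf_nth card_Un_disjoint graded_finiteD disjoint_iff)
qed

lemma gf_Times:
  assumes A: "graded_finite A w" and B: "graded_finite B v"
  shows "gf (A \<times> B) (\<lambda>(x, y). w x + v y) = gf A w * gf B v"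
proof (rule fps_ext)
  fix n
  let ?C = "\<lambda>i. {x\<in>A. w x = i} \<times> {y\<in>B. v y = n - i}"
  have "{p \<in> A \<times> B. (case p of (x, y) \<Rightarrow> w x + v y) = n} = (\<Union>i\<in>{0..n}. ?C i)" by auto
  then have "card {p \<in> A \<times> B. (case p of (x, y) \<Rightarrow> w x + v y) = n} = (\<Sum>i=0..n. card (?C i))"
    by (simp only:) (rule card_UN_disjoint, auto simp: graded_finiteD A B)
  then show "fps_nth (gf (A \<times> B) (\<lambda>(x, y). w x + v y)) n = fps_nth (gf A w * gf B v) n"
    by (simp add: gf_nth fps_mult_nth card_cartesian_product)
qed

text \<open>Two weighted sets may be compared fibre by fibre along statistics with values in an arbitrary,
  possibly infinite type: in each weight only finitely many fibres are nonempty. This replaces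
  infinite sums of power series.\<close>
lemma gf_by_statistic:
  assumes A: "graded_finite A w" and B: "graded_finite B v"
    and eq: "\<And>c. gf {x\<in>A. f x = c} w = gf {y\<in>B. g y = c} v"
  shows "gf A w = gf B v"
proof (rule fps_ext)
  fix n
  let ?S = "{x\<in>A. w x = n}" and ?T = "{y\<in>B. v y = n}"
  have fin: "finite ?S" "finite ?T" using A B by (auto simp: graded_finiteD)
  let ?I = "f ` ?S \<union> g ` ?T"
  have "{x\<in>?S. f x = c} = {x \<in> {x\<in>A. f x = c}. w x = n}"
    "{y\<in>?T. g y = c} = {y \<in> {y\<in>B. g y = c}. v y = n}" for c by auto
  then have fib: "card {x\<in>?S. f x = c} = card {y\<in>?T. g y = c}" for c
    using arg_cong[OF eq[of c], of "\<lambda>F. fps_nth F n"] by (simp add: gf_nth)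
  have finS: "finite {x\<in>?S. f x = c}" for c by (rule finite_subset[OF _ fin(1)]) auto
  have finT: "finite {y\<in>?T. g y = c}" for c by (rule finite_subset[OF _ fin(2)]) auto
  have "card ?S = card (\<Union>c\<in>?I. {x\<in>?S. f x = c})" by (rule arg_cong[of _ _ card]) auto
  also have "\<dots> = (\<Sum>c\<in>?I. card {x\<in>?S. f x = c})"
    by (rule card_UN_disjoint) (use fin finS in \<open>(blast, blast, fastforce)\<close>)
  also have "\<dots> = (\<Sum>c\<in>?I. card {y\<in>?T. g y = c})" by (simp only: fib)
  also have "\<dots> = card (\<Union>c\<in>?I. {y\<in>?T. g y = c})"
    by (rule card_UN_disjoint[symmetric]) (use fin finT in \<open>(blast, blast, fastforce)\<close>)
  also have "\<dots> = card ?T" by (rule arg_cong[of _ _ card]) auto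
  finally show "fps_nth (gf A w) n = fps_nth (gf B v) n" by (simp add: gf_nth)
qed

lemma gf_Sigma_cong:
  assumes "graded_finite (Sigma I A) (\<lambda>(c, x). w c x)" "graded_finite (Sigma I B) (\<lambda>(c, x). v c x)"
    and eq: "\<And>c. c \<in> I \<Longrightarrow> gf (A c) (w c) = gf (B c) (v c)"
  shows "gf (Sigma I A) (\<lambda>(c, x). w c x) = gf (Sigma I B) (\<lambda>(c, x). v c x)"
proof (rule gf_by_statistic[OF assms(1,2), of fst fst])
  fix c
  show "gf {p \<in> Sigma I A. fst p = c} (\<lambda>(c, x). w c x)
      = gf {p \<in> Sigma I B. fst p = c} (\<lambda>(c, x). v c x)"
  proof (cases "c \<in> I")
    case True
    have "gf {p \<in> Sigma I A. fst p = c} (\<lambda>(c, x). w c x) = gf (A c) (w c)"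
      by (rule gf_bij[of "Pair c"]) (use True in \<open>auto simp: bij_betw_def inj_on_def\<close>)
    moreover have "gf {p \<in> Sigma I B. fst p = c} (\<lambda>(c, x). v c x) = gf (B c) (v c)"
      by (rule gf_bij[of "Pair c"]) (use True in \<open>auto simp: bij_betw_def inj_on_def\<close>)
    ultimately show ?thesis using eq[OF True] by simp
  next
    case False
    then have "{p \<in> Sigma I A. fst p = c} = {}" "{p \<in> Sigma I B. fst p = c} = {}" by auto
    then show ?thesis by (simp only:) (simp add: gf_def)
  qed
qed

section \<open>Partitions with bounded parts\<close>

definition parts_ge :: "nat \<Rightarrow> nat multiset set" where
  "parts_ge m = {M. \<forall>x\<in>#M. m \<le> x}"

lemma finite_bounded_size_sum: "finite {M :: nat multiset. size M \<le> N \<and> sum_mset M \<le> n}"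
proof -
  have "{M :: nat multiset. size M \<le> N \<and> sum_mset M \<le> n}
      \<subseteq> mset ` {xs. set xs \<subseteq> {0..n} \<and> length xs \<le> N}"
  proof
    fix M :: "nat multiset" assume M: "M \<in> {M. size M \<le> N \<and> sum_mset M \<le> n}"
    obtain xs where xs: "mset xs = M" using ex_mset by blast
    have "x \<le> n" if "x \<in># M" for x using multi_member_split[OF that] M by auto
    then show "M \<in> mset ` {xs. set xs \<subseteq> {0..n} \<and> length xs \<le> N}"
      using M xs by (intro image_eqI[of _ _ xs]) auto
  qed
  then show ?thesis
    by (rule finite_subset) (intro finite_imageI finite_lists_length_le, simp)
qed

lemma size_le_sum_mset: "M \<in> parts_ge 1 \<Longrightarrow> size M \<le> sum_mset M"
  by (induction M) (auto simp: parts_ge_def)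

lemma graded_finite_parts_ge_1: "graded_finite (parts_ge 1) sum_mset"
  unfolding graded_finite_def
proof
  fix n
  have "{M \<in> parts_ge 1. sum_mset M \<le> n} \<subseteq> {M. size M \<le> n \<and> sum_mset M \<le> n}"
    using size_le_sum_mset order_trans by fastforce
  then show "finite {M \<in> parts_ge 1. sum_mset M \<le> n}"
    using finite_bounded_size_sum finite_subset by blast
qed

lemma graded_finite_parts: "A \<subseteq> parts_ge 1 \<Longrightarrow> graded_finite A sum_mset"
  using graded_finite_subset graded_finite_parts_ge_1 by blast

lemma parts_ge_antimono: "m \<le> n \<Longrightarrow> parts_ge n \<subseteq> parts_ge m"
  by (auto simp: parts_ge_def)

text \<open>The source of all recursions here: the members of \<open>A\<close> that contain \<open>k\<close> lose one copy of it.\<close>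
lemma gf_split_part:
  assumes fin: "graded_finite A sum_mset"
  shows "gf A sum_mset = gf {M\<in>A. k \<notin># M} sum_mset + fps_X ^ k * gf {M. add_mset k M \<in> A} sum_mset"
proof -
  have "gf A sum_mset = gf ({M\<in>A. k \<notin># M} \<union> {M\<in>A. k \<in># M}) sum_mset"
    by (rule arg_cong[of _ _ "\<lambda>A. gf A sum_mset"]) auto
  also have "\<dots> = gf {M\<in>A. k \<notin># M} sum_mset + gf {M\<in>A. k \<in># M} sum_mset"
    by (rule gf_Un) (auto intro: graded_finite_subset[OF fin])
  also have "gf {M\<in>A. k \<in># M} sum_mset = fps_X ^ k * gf {M. add_mset k M \<in> A} sum_mset"
  proof (rule gf_shift)
    show "bij_betw (add_mset k) {M. add_mset k M \<in> A} {M\<in>A. k \<in># M}"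
      by (rule bij_betw_byWitness[of _ "\<lambda>M. M - {#k#}"]) auto
  qed simp
  finally show ?thesis .
qed

abbreviation E :: "nat \<Rightarrow> int fps" where
  "E m \<equiv> gf (parts_ge m) sum_mset"

lemma E_Suc:
  assumes "m \<ge> 1"
  shows "E (Suc m) = (1 - fps_X ^ m) * E m"
proof -
  have 1: "{M \<in> parts_ge m. m \<notin># M} = parts_ge (Suc m)"
    by (auto simp: parts_ge_def Suc_le_eq order.strict_iff_order)
  have 2: "{M. add_mset m M \<in> parts_ge m} = parts_ge m" by (auto simp: parts_ge_def)
  have "E m = E (Suc m) + fps_X ^ m * E m"
    using gf_split_part[of "parts_ge m" m] 1 2 graded_finite_parts[OF parts_ge_antimono[OF assms]]
    by simp
  then show ?thesis by (simp add: algebra_simps)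
qed

text \<open>Multiplied by \<open>1 / E (b + 1)\<close>, the generating function of this set becomes a \<open>q\<close>-binomial
  coefficient, which counts the partitions in an \<open>a \<times> b\<close> box. Keeping the parts above \<open>b\<close> avoids this
  quotient.\<close>
definition few_small :: "nat \<Rightarrow> nat \<Rightarrow> nat multiset set" where
  "few_small a b = {M \<in> parts_ge 1. size (filter_mset (\<lambda>x. x \<le> b) M) \<le> a}"

lemma few_small_0_left: "few_small 0 b = parts_ge (Suc b)"
  by (force simp: few_small_def parts_ge_def not_le Suc_le_eq)

lemma few_small_0_right: "few_small a 0 = parts_ge 1"
proof -
  have "filter_mset (\<lambda>x. x \<le> 0) M = {#}" if "M \<in> parts_ge 1" for M
    using that by (auto simp: parts_ge_def)
  then have "size (filter_mset (\<lambda>x. x \<le> 0) M) \<le> a" if "M \<in> parts_ge 1" for M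
    by (simp only: that size_empty le0)
  then show ?thesis unfolding few_small_def by blast
qed

lemma filter_mset_le_Suc_if_notin:
  "Suc b \<notin># M \<Longrightarrow> filter_mset (\<lambda>x. x \<le> Suc b) M = filter_mset (\<lambda>x. x \<le> b) M"
  by (intro filter_mset_cong) (auto simp: le_Suc_eq)

text \<open>Removing one part \<open>b + 1\<close> from the members of \<open>few_small (a + 1) (b + 1)\<close> and of
  \<open>few_small (a + 1) b\<close> leads to \<open>few_small a (b + 1)\<close> and \<open>few_small (a + 1) b\<close>, respectively, while
  the members without such a part are the same in both cases; they are eliminated.\<close>
lemma gf_few_small_Suc_Suc:
  "gf (few_small (Suc a) (Suc b)) sum_mset =
     fps_X ^ Suc b * gf (few_small a (Suc b)) sum_mset
   + (1 - fps_X ^ Suc b) * gf (few_small (Suc a) b) sum_mset"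
proof -
  let ?N = "{M \<in> few_small (Suc a) b. Suc b \<notin># M}"
  have fin: "graded_finite (few_small a b) sum_mset" for a b
    by (rule graded_finite_parts) (auto simp: few_small_def)
  have N: "{M \<in> few_small (Suc a) (Suc b). Suc b \<notin># M} = ?N"
    by (auto simp: few_small_def filter_mset_le_Suc_if_notin)
  have "{M. add_mset (Suc b) M \<in> few_small (Suc a) (Suc b)} = few_small a (Suc b)"
    "{M. add_mset (Suc b) M \<in> few_small (Suc a) b} = few_small (Suc a) b"
    by (auto simp: few_small_def parts_ge_def)
  then have "gf (few_small (Suc a) (Suc b)) sum_mset
        = gf ?N sum_mset + fps_X ^ Suc b * gf (few_small a (Suc b)) sum_mset"
      "gf (few_small (Suc a) b) sum_mset
        = gf ?N sum_mset + fps_X ^ Suc b * gf (few_small (Suc a) b) sum_mset"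
    using gf_split_part[OF fin, of "Suc a" "Suc b" "Suc b"] gf_split_part[OF fin, of "Suc a" b "Suc b"]
    by (simp_all only: N)
  then show ?thesis by (simp add: algebra_simps)
qed

text \<open>The induction closes because \<open>q\<^sup>b (1 - q\<^sup>a) + (1 - q\<^sup>b) = 1 - q\<^bsup>a + b\<^esup>\<close>. The right-hand side depends
  on \<open>a + b\<close> only, which makes the sum over the smallest black part geometric.\<close>
lemma gf_few_small: "E (Suc a) * gf (few_small a b) sum_mset = E 1 * E (Suc (a + b))"
proof (induction "a + b" arbitrary: a b rule: less_induct)
  case less
  show ?case
  proof (cases a)
    case 0
    then show ?thesis by (simp add: few_small_0_left)
  next
    case (Suc a')
    note a = this
    show ?thesis
    proof (cases b)
      case 0
      then show ?thesis using few_small_0_right[of a] by simp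
    next
      case (Suc b')
      let ?q = "fps_X :: int fps"
      let ?D = "\<lambda>a b. gf (few_small a b) sum_mset"
      have IH1: "E a * ?D a' b = E 1 * E (a + b)" using less[of a' b] a by simp
      have IH2: "E (Suc a) * ?D a b' = E 1 * E (a + b)" using less[of a b'] Suc by simp
      have D: "?D a b = ?q ^ b * ?D a' b + (1 - ?q ^ b) * ?D a b'"
        using gf_few_small_Suc_Suc[of a' b'] a Suc by simp
      have "E (Suc a) * ?D a b
          = ?q ^ b * (E (Suc a) * ?D a' b) + (1 - ?q ^ b) * (E (Suc a) * ?D a b')"
        unfolding D by (simp add: algebra_simps)
      also have "E (Suc a) * ?D a' b = (1 - ?q ^ a) * (E a * ?D a' b)"
        using E_Suc[of a] a by simp
      also have "?q ^ b * ((1 - ?q ^ a) * (E a * ?D a' b)) + (1 - ?q ^ b) * (E (Suc a) * ?D a b')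
          = (1 - ?q ^ (a + b)) * (E 1 * E (a + b))"
        unfolding IH1 IH2 by (simp add: algebra_simps power_add)
      also have "\<dots> = E 1 * E (Suc (a + b))" using E_Suc[of "a + b"] a by simp
      finally show ?thesis .
    qed
  qed
qed

section \<open>Black and red parts\<close>

text \<open>For \<open>k = Min_mset b\<close>, this is the inequality \<open>k + i\<^sub>k \<ge> m\<close> with \<open>i\<^sub>k = \<infinity>\<close> when undefined: the \<open>k\<close>-th
  smallest part of \<open>d\<close> is at least \<open>m - k\<close> exactly when fewer than \<open>k\<close> parts are smaller than
  \<open>m - k\<close>.\<close>
definition threshold :: "nat \<Rightarrow> nat multiset \<Rightarrow> nat multiset \<Rightarrow> bool" where
  "threshold m b d \<longleftrightarrow> b = {#} \<or> size (filter_mset (\<lambda>x. x + Min_mset b < m) d) < Min_mset b"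

abbreviation pair_sum :: "nat multiset \<times> nat multiset \<Rightarrow> nat" where
  "pair_sum \<equiv> \<lambda>(b, d). sum_mset b + sum_mset d"

lemma graded_finite_pair: "A \<subseteq> parts_ge 1 \<times> parts_ge 1 \<Longrightarrow> graded_finite A pair_sum"
  by (rule graded_finite_subset[OF graded_finite_Times[OF graded_finite_parts_ge_1 graded_finite_parts_ge_1]])

lemma gf_Min_eq:
  assumes "k \<ge> 1"
  shows "gf {b. b \<noteq> {#} \<and> Min_mset b = k} sum_mset = fps_X ^ k * E k"
proof (rule gf_shift)
  have min: "Min (insert k (set_mset M)) = k" if "M \<in> parts_ge k" for M
    using that by (intro Min_eqI) (auto simp: parts_ge_def)
  have "M - {#Min_mset M#} \<in> parts_ge (Min_mset M)" if "M \<noteq> {#}" for M :: "nat multiset"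
    by (auto simp: parts_ge_def dest: in_diffD)
  moreover have "Min_mset M \<in># M" if "M \<noteq> {#}" for M :: "nat multiset" using that by simp
  ultimately show "bij_betw (add_mset k) (parts_ge k) {b. b \<noteq> {#} \<and> Min_mset b = k}"
    by (intro bij_betw_byWitness[of _ "\<lambda>M. M - {#k#}"]) (auto simp: min)
qed simp

text \<open>Lowering the bound on the black parts from \<open>t + 1\<close> to \<open>t\<close> adds the pairs with smallest black part \<open>t\<close>, which
  contribute \<open>q\<^sup>t * E 1 * E (m - 1)\<close> by \<open>gf_few_small\<close>. For \<open>t = m\<close> there is no condition left on the
  red parts.\<close>
lemma gf_threshold_from:
  assumes "1 \<le> t" "t \<le> m" "2 \<le> m"
  shows "(1 - fps_X) * gf {(b, d). b \<in> parts_ge t \<and> d \<in> parts_ge 1 \<and> threshold m b d} pair_sum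
    = E 1 * E (m - 1) * (1 - fps_X - fps_X ^ (m - 1) + fps_X ^ t)"
  using assms(2,1)
proof (induction t rule: inc_induct)
  case base
  let ?q = "fps_X :: int fps"
  have "threshold m b d" if "b \<in> parts_ge m" for b d
  proof (cases "b = {#}")
    case False
    then have "m \<le> Min_mset b" using that by (auto simp: parts_ge_def)
    then show ?thesis using assms by (auto simp: threshold_def)
  qed (simp add: threshold_def)
  then have "{(b, d). b \<in> parts_ge m \<and> d \<in> parts_ge 1 \<and> threshold m b d} = parts_ge m \<times> parts_ge 1"
    by auto
  moreover have "gf (parts_ge m \<times> parts_ge 1) pair_sum = E m * E 1"
    by (rule gf_Times[OF graded_finite_parts graded_finite_parts_ge_1])
      (use assms in \<open>simp add: parts_ge_antimono\<close>)
  moreover have "E m = (1 - ?q ^ (m - 1)) * E (m - 1)" using E_Suc[of "m - 1"] assms by simp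
  moreover have "?q ^ m = ?q * ?q ^ (m - 1)" using assms by (cases m) auto
  ultimately have "(1 - ?q) * gf {(b, d). b \<in> parts_ge m \<and> d \<in> parts_ge 1 \<and> threshold m b d} pair_sum
      = (1 - ?q) * ((1 - ?q ^ (m - 1)) * E (m - 1) * E 1)" by (simp only:)
  also have "\<dots> = E 1 * E (m - 1) * (1 - ?q - ?q ^ (m - 1) + ?q * ?q ^ (m - 1))"
    by (simp add: algebra_simps)
  finally show ?case using \<open>?q ^ m = ?q * ?q ^ (m - 1)\<close> by (simp only:)
next
  case (step t)
  let ?q = "fps_X :: int fps"
  let ?Q = "\<lambda>t. {(b, d). b \<in> parts_ge t \<and> d \<in> parts_ge 1 \<and> threshold m b d}"
  let ?M = "{b. b \<noteq> {#} \<and> Min_mset b = t} \<times> few_small (t - 1) (m - t - 1)"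
  have t: "1 \<le> t" "t < m" using step by auto
  \<comment> \<open>\<open>x + t < m\<close> is \<open>x \<le> m - t - 1\<close>, and fewer than \<open>t\<close> is at most \<open>t - 1\<close>; both need \<open>1 \<le> t < m\<close>.\<close>
  have red: "threshold m b d \<longleftrightarrow> d \<in> few_small (t - 1) (m - t - 1)"
    if "b \<noteq> {#}" "Min_mset b = t" "d \<in> parts_ge 1" for b d
  proof -
    have "(\<lambda>x. x + t < m) = (\<lambda>x. x \<le> m - t - 1)" using t by auto
    then show ?thesis using that t by (auto simp: threshold_def few_small_def)
  qed
  have ge: "b \<in> parts_ge (Suc t) \<longleftrightarrow> b \<in> parts_ge t \<and> \<not> (b \<noteq> {#} \<and> Min_mset b = t)" for b
  proof (cases "b = {#}")
    case False
    then have "b \<in> parts_ge k \<longleftrightarrow> k \<le> Min_mset b" for k by (simp add: parts_ge_def)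
    then show ?thesis using False by (simp only: Suc_le_eq order.strict_iff_order) auto
  qed (simp add: parts_ge_def)
  have min: "b \<in> parts_ge t" if "b \<noteq> {#}" "Min_mset b = t" for b
    using that by (auto simp: parts_ge_def)
  have split: "?Q t = ?Q (Suc t) \<union> ?M" "?Q (Suc t) \<inter> ?M = {}"
    using red min by (auto simp: ge) (auto simp: few_small_def)
  have fin: "graded_finite A pair_sum" if "A \<subseteq> ?Q t" for A
    by (rule graded_finite_pair) (use that t parts_ge_antimono[of 1 t] in auto)
  have prod: "gf ?M pair_sum = ?q ^ t * E t * gf (few_small (t - 1) (m - t - 1)) sum_mset"
    unfolding gf_Min_eq[OF t(1), symmetric]
    by (rule gf_Times; rule graded_finite_parts)
      (use min parts_ge_antimono[of 1 t] t in \<open>auto simp: few_small_def\<close>)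
  have M: "gf ?M pair_sum = ?q ^ t * (E 1 * E (m - 1))"
  proof -
    have "Suc (t - 1) = t" "Suc (t - 1 + (m - t - 1)) = m - 1" using t by auto
    then show ?thesis using prod gf_few_small[of "t - 1" "m - t - 1"] by (simp only: mult.assoc)
  qed
  have "gf (?Q t) pair_sum = gf (?Q (Suc t)) pair_sum + gf ?M pair_sum"
    unfolding split(1) by (rule gf_Un) (use split fin in auto)
  then show ?case using step.IH M by (simp add: algebra_simps)
qed

definition ones :: "nat multiset set" where
  "ones = {M. set_mset M \<subseteq> {1}}"

lemma ones_subset: "ones \<subseteq> parts_ge 1"
  by (auto simp: ones_def parts_ge_def)

lemma gf_ones: "(1 - fps_X) * gf ones sum_mset = 1"
proof -
  have "{M \<in> ones. 1 \<notin># M} = {{#}}" "{M. add_mset 1 M \<in> ones} = ones"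
    by (auto simp: ones_def)
  moreover have "gf {{#} :: nat multiset} sum_mset = 1"
  proof (rule fps_ext)
    fix n
    have "{M \<in> {{#} :: nat multiset}. sum_mset M = n} = (if n = 0 then {{#}} else {})" by auto
    then show "fps_nth (gf {{#} :: nat multiset} sum_mset) n = fps_nth 1 n" by (simp add: gf_nth)
  qed
  ultimately show ?thesis
    using gf_split_part[OF graded_finite_parts[OF ones_subset], of 1] by (simp add: algebra_simps)
qed

lemma gf_threshold:
  assumes "2 \<le> m"
  shows "gf {(b, d). b \<in> parts_ge 1 \<and> d \<in> parts_ge 1 \<and> threshold m b d} pair_sum
    = gf ones sum_mset * E 1 * E m" (is "?P = _")
proof -
  have m: "1 \<le> m" using assms by simp
  have "E m = (1 - fps_X ^ (m - 1)) * E (m - 1)" using E_Suc[of "m - 1"] assms by simp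
  then have "E 1 * E (m - 1) * (1 - fps_X - fps_X ^ (m - 1) + fps_X ^ 1) = E 1 * E m"
    by (simp only: power_one_right) (simp add: algebra_simps)
  with gf_threshold_from[OF order_refl m assms] have P: "(1 - fps_X) * ?P = E 1 * E m"
    by (rule trans)
  have "((1 - fps_X) * gf ones sum_mset) * ?P = gf ones sum_mset * ((1 - fps_X) * ?P)"
    by (simp only: ac_simps)
  also have "\<dots> = gf ones sum_mset * E 1 * E m" by (simp only: P mult.assoc)
  finally have "((1 - fps_X) * gf ones sum_mset) * ?P = gf ones sum_mset * E 1 * E m" .
  then show ?thesis by (simp add: gf_ones)
qed


section \<open>Green parts and large parts\<close>

text \<open>The partitions in \<open>\<B>\<^bsub>r,r\<^esub>\<close>, described by multiplicities. As \<open>0\<close> is not a part, the instance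
  \<open>i = 0\<close> bounds the number of ones.\<close>
definition gordon :: "nat \<Rightarrow> nat multiset set" where
  "gordon r = {M \<in> parts_ge 1. \<forall>i. count M i + count M (Suc i) < r}"

definition parts_above_1 :: "nat multiset \<Rightarrow> nat" where
  "parts_above_1 M = size M - count M 1"

lemma sum_mset_image_add: "sum_mset (image_mset (\<lambda>x. x + m) M) = size M * m + sum_mset M" for m :: nat
  by (induction M) auto

lemma gf_parts_ge_size_shift:
  "gf {M \<in> parts_ge m. size M = l} sum_mset = fps_X ^ (l * m) * gf {M. size M = l} sum_mset"
proof (rule gf_shift)
  have up_down: "image_mset (\<lambda>x. x - m + m) M = M" if "M \<in> parts_ge m" for M
    using that by (induction M) (auto simp: parts_ge_def)
  show "bij_betw (image_mset (\<lambda>x. x + m)) {M. size M = l} {M \<in> parts_ge m. size M = l}"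
    by (rule bij_betw_byWitness[of _ "image_mset (\<lambda>x. x - m)"])
      (auto simp: multiset.map_comp comp_def up_down, auto simp: parts_ge_def)
qed (auto simp: sum_mset_image_add)

text \<open>Partitions into at most \<open>l\<close> parts, padded with zeros, against partitions into parts at most \<open>l\<close>.
  Instead of conjugation, a common recursion is used: passing from \<open>l\<close> to \<open>l + 1\<close> divides both series
  by \<open>1 - q\<^bsup>l + 1\<^esup>\<close>. On the left, a member either loses a zero or can have all its \<open>l + 1\<close> parts lowered
  by \<open>1\<close>; on the right, it either has no part \<open>l + 1\<close> or loses one.\<close>
lemma gf_size_eq: "gf {M :: nat multiset. size M = l} sum_mset = gf {M. set_mset M \<subseteq> {1..l}} sum_mset"
proof (induction l)
  case 0
  have "{M :: nat multiset. size M = 0} = {M. set_mset M \<subseteq> {1..0}}" by auto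
  then show ?case by (simp only:)
next
  case (Suc l)
  let ?Y = "\<lambda>l. {M :: nat multiset. size M = l}" and ?Z = "\<lambda>l. {M. set_mset M \<subseteq> {1..l :: nat}}"
  have finY: "graded_finite (?Y l) sum_mset" for l
    unfolding graded_finite_def
    by (intro allI finite_subset[OF _ finite_bounded_size_sum[of l]]) auto
  have finZ: "graded_finite (?Z l) sum_mset" for l
    by (rule graded_finite_parts) (auto simp: parts_ge_def)
  have "{M \<in> ?Y (Suc l). 0 \<notin># M} = {M \<in> parts_ge 1. size M = Suc l}"
    by (auto simp: parts_ge_def Suc_le_eq) (metis gr0I)
  moreover have "{M. add_mset 0 M \<in> ?Y (Suc l)} = ?Y l" by auto
  ultimately have "gf (?Y (Suc l)) sum_mset
      = fps_X ^ Suc l * gf (?Y (Suc l)) sum_mset + gf (?Y l) sum_mset"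
    using gf_split_part[OF finY, of "Suc l" 0] gf_parts_ge_size_shift[of 1 "Suc l"]
    by (simp only: power_0 mult_1 mult_1_right)
  then have Y: "(1 - fps_X ^ Suc l) * gf (?Y (Suc l)) sum_mset = gf (?Y l) sum_mset"
    by (simp only: left_diff_distrib mult_1 diff_eq_eq add.commute)
  have "{M \<in> ?Z (Suc l). Suc l \<notin># M} = ?Z l"
    by (auto simp: subset_iff) (metis le_Suc_eq)+
  moreover have "{M. add_mset (Suc l) M \<in> ?Z (Suc l)} = ?Z (Suc l)" by auto
  ultimately have "gf (?Z (Suc l)) sum_mset
      = gf (?Z l) sum_mset + fps_X ^ Suc l * gf (?Z (Suc l)) sum_mset"
    using gf_split_part[OF finZ, of "Suc l" "Suc l"] by (simp only:)
  then have Z: "(1 - fps_X ^ Suc l) * gf (?Z (Suc l)) sum_mset = gf (?Z l) sum_mset"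
    by (simp only: left_diff_distrib mult_1 diff_eq_eq add.commute)
  have "(1 - fps_X ^ Suc l :: int fps) \<noteq> 0"
    by (rule fps_nonzeroI[of _ 0]) simp
  then show ?case using Y Z Suc by (metis mult_left_cancel)
qed

lemma gf_parts_ge_size:
  "gf {M \<in> parts_ge m. size M = l} sum_mset = fps_X ^ (l * m) * gf {M. set_mset M \<subseteq> {1..l}} sum_mset"
  by (simp only: gf_parts_ge_size_shift gf_size_eq)

text \<open>The value \<open>0\<close> is always admitted, as if the part \<open>0\<close> had infinite multiplicity; for \<open>r \<ge> 1\<close>, the
  partitions of level \<open>0\<close> are exactly those in \<open>gordon r\<close>.\<close>
definition level :: "nat \<Rightarrow> nat multiset \<Rightarrow> nat" where
  "level r M = Max {l. l = 0 \<or> r \<le> count M l + count M (Suc l)}"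

lemma level_eq_iff:
  assumes "r \<ge> 1"
  shows "level r M = l \<longleftrightarrow>
    (l = 0 \<or> r \<le> count M l + count M (Suc l)) \<and> (\<forall>i>l. count M i + count M (Suc i) < r)"
proof -
  let ?S = "{l. l = 0 \<or> r \<le> count M l + count M (Suc l)}"
  have "i \<in> insert 0 (set_mset M \<union> (\<lambda>x. x - 1) ` set_mset M)" if "i \<in> ?S" for i
  proof -
    have "i = 0 \<or> i \<in># M \<or> Suc i \<in># M"
      using that assms by (cases "i \<in># M") (auto simp: not_in_iff)
    then show ?thesis by (auto simp: image_iff intro: bexI[of _ "Suc i"])
  qed
  then have "finite ?S" by (intro finite_subset[of ?S "insert 0 (set_mset M \<union> (\<lambda>x. x - 1) ` set_mset M)"]) auto
  moreover have "?S \<noteq> {}" by auto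
  ultimately have "level r M = l \<longleftrightarrow> l \<in> ?S \<and> (\<forall>i\<in>?S. i \<le> l)"
    unfolding level_def by (rule Max_eq_iff)
  then show ?thesis by (auto simp: not_le[symmetric])
qed

definition glue :: "nat \<Rightarrow> nat \<Rightarrow> nat multiset \<times> nat multiset \<Rightarrow> nat multiset" where
  "glue r l = (\<lambda>(G, Z). Z + replicate_mset (r - count G 1) l + image_mset (\<lambda>x. x + l) G)"

definition unglue :: "nat \<Rightarrow> nat \<Rightarrow> nat multiset \<Rightarrow> nat multiset \<times> nat multiset" where
  "unglue r l M = (image_mset (\<lambda>x. x - l) (filter_mset (\<lambda>x. l < x) M),
     filter_mset (\<lambda>x. x \<le> l) M - replicate_mset (r - count M (Suc l)) l)"

lemma count_shift_up: "count (image_mset (\<lambda>x. x + l) M) i = (if l \<le> i then count M (i - l) else 0)" for l :: nat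
  by (induction M) auto

lemma count_shift_down:
  "count (image_mset (\<lambda>x. x - l) (filter_mset (\<lambda>x. l < x) M)) i = (if i = 0 then 0 else count M (i + l))" for l :: nat
  by (induction M) auto

lemma count_0_parts_ge_1: "M \<in> parts_ge 1 \<Longrightarrow> count M 0 = 0"
  by (force simp: parts_ge_def count_eq_zero_iff)

lemma unglue_glue:
  assumes "G \<in> parts_ge 1" "set_mset Z \<subseteq> {1..l}"
  shows "unglue r l (glue r l (G, Z)) = (G, Z)"
proof -
  let ?M = "glue r l (G, Z)"
  have "count ?M (Suc l) = count G 1"
    using assms(2) by (auto simp: glue_def count_shift_up count_eq_zero_iff)
  moreover have "filter_mset (\<lambda>x. x \<le> l) ?M = Z + replicate_mset (r - count G 1) l"
    by (rule multiset_eqI)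
      (use assms in \<open>auto simp: glue_def count_shift_up count_0_parts_ge_1 count_eq_zero_iff\<close>)
  moreover have "image_mset (\<lambda>x. x - l) (filter_mset (\<lambda>x. l < x) ?M) = G"
    by (rule multiset_eqI)
      (use assms in \<open>auto simp: count_shift_down count_0_parts_ge_1 glue_def count_shift_up count_eq_zero_iff\<close>)
  ultimately show ?thesis by (simp add: unglue_def)
qed

lemma glue_unglue:
  assumes "r \<le> count M l + count M (Suc l)"
  shows "glue r l (unglue r l M) = M"
proof (rule multiset_eqI)
  fix i
  show "count (glue r l (unglue r l M)) i = count M i"
    using assms by (auto simp: glue_def unglue_def count_shift_up count_shift_down)
qed

text \<open>Above \<open>l\<close> the glued partition has the multiplicities of \<open>G\<close>, shifted by \<open>l\<close>, so no two consecutive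
  sizes above \<open>l\<close> reach a total multiplicity of \<open>r\<close>. The sizes \<open>l\<close> and \<open>l + 1\<close> do reach it: the ones
  of \<open>G\<close> become parts \<open>l + 1\<close>, and together with the copies of \<open>l\<close> added they number \<open>r\<close>. Conversely,
  the multiplicity of \<open>l + 1\<close> tells how many copies of \<open>l\<close> have to be taken out.\<close>
lemma bij_glue:
  assumes "r \<ge> 1" "l \<ge> 1"
  shows "bij_betw (glue r l) (gordon r \<times> {Z. set_mset Z \<subseteq> {1..l}}) {M \<in> parts_ge 1. level r M = l}"
proof (rule bij_betw_byWitness[of _ "unglue r l"])
  show "\<forall>p\<in>gordon r \<times> {Z. set_mset Z \<subseteq> {1..l}}. unglue r l (glue r l p) = p"
    by (auto simp: unglue_glue gordon_def)
  show "\<forall>M\<in>{M \<in> parts_ge 1. level r M = l}. glue r l (unglue r l M) = M"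
    using assms by (auto simp: level_eq_iff glue_unglue)
  show "glue r l ` (gordon r \<times> {Z. set_mset Z \<subseteq> {1..l}}) \<subseteq> {M \<in> parts_ge 1. level r M = l}"
  proof (intro image_subsetI)
    fix p assume "p \<in> gordon r \<times> {Z. set_mset Z \<subseteq> {1..l}}"
    then obtain G Z where p: "p = (G, Z)" and G: "G \<in> parts_ge 1" "\<And>i. count G i + count G (Suc i) < r"
      and Z: "set_mset Z \<subseteq> {1..l}" by (auto simp: gordon_def)
    have above: "count (glue r l p) i = count G (i - l)" if "i > l" for i
      using that Z by (auto simp: p glue_def count_shift_up count_eq_zero_iff)
    have "count (glue r l p) l \<ge> r - count G 1" by (simp add: p glue_def)
    moreover have "count G 1 < r" using G(2)[of 0] by simp
    ultimately have "r \<le> count (glue r l p) l + count (glue r l p) (Suc l)" by (simp add: above)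
    moreover have "count (glue r l p) i + count (glue r l p) (Suc i) < r" if "i > l" for i
      using that G(2)[of "i - l"] by (simp add: above Suc_diff_le)
    moreover have "glue r l p \<in> parts_ge 1"
      using Z assms by (auto simp: p glue_def parts_ge_def)
    ultimately show "glue r l p \<in> {M \<in> parts_ge 1. level r M = l}"
      using assms by (simp add: level_eq_iff)
  qed
  show "unglue r l ` {M \<in> parts_ge 1. level r M = l} \<subseteq> gordon r \<times> {Z. set_mset Z \<subseteq> {1..l}}"
  proof (intro image_subsetI)
    fix M assume "M \<in> {M \<in> parts_ge 1. level r M = l}"
    then have M: "M \<in> parts_ge 1" and lev: "\<And>i. i > l \<Longrightarrow> count M i + count M (Suc i) < r"
      using assms by (auto simp: level_eq_iff)
    let ?G = "fst (unglue r l M)"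
    have count: "count ?G i = (if i = 0 then 0 else count M (i + l))" for i
      by (simp add: unglue_def count_shift_down)
    have "count ?G i + count ?G (Suc i) < r" for i
    proof (cases "i = 0")
      case True
      then show ?thesis using lev[of "Suc l"] by (simp add: count)
    next
      case False
      then show ?thesis using lev[of "i + l"] by (simp add: count)
    qed
    moreover have "?G \<in> parts_ge 1" by (auto simp: unglue_def parts_ge_def)
    moreover have "set_mset (snd (unglue r l M)) \<subseteq> {1..l}"
      using M by (auto simp: unglue_def parts_ge_def dest!: in_diffD)
    ultimately show "unglue r l M \<in> gordon r \<times> {Z. set_mset Z \<subseteq> {1..l}}"
      by (simp add: gordon_def mem_Times_iff)
  qed
qed

text \<open>Shifting \<open>G\<close> adds \<open>l * size G\<close>, and the extra copies of \<open>l\<close> replace \<open>l * count G 1\<close> by \<open>l * r\<close>.\<close>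
lemma sum_mset_glue:
  assumes "G \<in> gordon r"
  shows "sum_mset (glue r l (G, Z)) = sum_mset G + l * (r + parts_above_1 G) + sum_mset Z"
proof -
  have "count G 0 + count G (Suc 0) < r" using assms by (simp add: gordon_def)
  then have r: "r = count G 1 + (r - count G 1)" by simp
  have size: "size G = count G 1 + parts_above_1 G"
    using count_le_size[of G 1] by (simp add: parts_above_1_def)
  have "sum_mset (glue r l (G, Z)) = sum_mset Z + (r - count G 1) * l + (size G * l + sum_mset G)"
    by (simp add: glue_def sum_mset_image_add)
  also have "\<dots> = sum_mset G + l * (count G 1 + (r - count G 1) + parts_above_1 G) + sum_mset Z"
    unfolding size by (simp only: algebra_simps)
  finally show ?thesis using r by simp
qed

lemma gf_level:
  assumes "r \<ge> 1"
  shows "gf {M \<in> parts_ge 1. level r M = l} sum_mset =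
    gf (gordon r \<times> {Z. set_mset Z \<subseteq> {1..l}}) (\<lambda>(G, Z). sum_mset G + l * (r + parts_above_1 G) + sum_mset Z)"
proof (cases "l = 0")
  case True
  have "count M 0 + count M 1 < r"
    if "M \<in> parts_ge 1" "\<forall>i>0. count M i + count M (Suc i) < r" for M
    using that(2)[rule_format, of 1] count_0_parts_ge_1[OF that(1)] by simp
  then have "{M \<in> parts_ge 1. level r M = 0} = gordon r"
    using assms by (auto simp: level_eq_iff gordon_def) (metis One_nat_def gr0I)
  moreover have "bij_betw fst (gordon r \<times> {{#} :: nat multiset}) (gordon r)"
    by (auto simp: bij_betw_def inj_on_def)
  ultimately show ?thesis
    using gf_bij[of fst "gordon r \<times> {{#} :: nat multiset}" "gordon r" sum_mset "\<lambda>(G, Z). sum_mset G + 0 * (r + parts_above_1 G) + sum_mset Z"] True by auto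
next
  case False
  then show ?thesis
    using assms by (intro gf_bij[OF bij_glue]) (auto simp: sum_mset_glue)
qed

lemma gf_add_const: "gf A (\<lambda>x. d + w x) = fps_X ^ d * gf A w"
  by (rule gf_shift[of id]) auto

text \<open>The bound on the parts of \<open>B\<close> enters its weight only through the number of parts, so both sides
  are compared for each number \<open>l\<close> of parts of \<open>B\<close>, respectively each level \<open>l\<close>.\<close>
lemma gf_gordon_large_parts:
  assumes "r \<ge> 1"
  shows "gf (SIGMA G:gordon r. parts_ge (r + parts_above_1 G)) (\<lambda>(G, B). sum_mset G + sum_mset B) = E 1"
proof (rule gf_by_statistic[of _ _ _ _ "\<lambda>p. size (snd p)" "level r"])
  let ?S = "SIGMA G:gordon r. parts_ge (r + parts_above_1 G)"
  have "?S \<subseteq> parts_ge 1 \<times> parts_ge 1" using assms by (auto simp: gordon_def parts_ge_def)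
  then show fin: "graded_finite ?S pair_sum" by (rule graded_finite_pair)
  show "graded_finite (parts_ge 1) sum_mset" by (rule graded_finite_parts_ge_1)
  fix l
  let ?S\<^sub>l = "SIGMA G:gordon r. {B \<in> parts_ge (r + parts_above_1 G). size B = l}"
  let ?T = "SIGMA G:gordon r. {Z. set_mset Z \<subseteq> {1..l}}"
  have "gf {p \<in> ?S. size (snd p) = l} pair_sum = gf ?S\<^sub>l pair_sum"
    by (rule arg_cong[of _ _ "\<lambda>A. gf A pair_sum"]) auto
  also have "\<dots> = gf ?T (\<lambda>(G, Z). sum_mset G + l * (r + parts_above_1 G) + sum_mset Z)"
  proof (rule gf_Sigma_cong)
    show "graded_finite ?S\<^sub>l pair_sum" by (rule graded_finite_subset[OF fin]) auto
    have "?T \<subseteq> parts_ge 1 \<times> parts_ge 1" by (auto simp: gordon_def parts_ge_def subset_iff)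
    then have "graded_finite ?T pair_sum" by (rule graded_finite_pair)
    then show "graded_finite ?T (\<lambda>(G, Z). sum_mset G + l * (r + parts_above_1 G) + sum_mset Z)"
      by (rule graded_finite_mono) auto
    fix G
    show "gf {B \<in> parts_ge (r + parts_above_1 G). size B = l} (\<lambda>B. sum_mset G + sum_mset B)
      = gf {Z. set_mset Z \<subseteq> {1..l}} (\<lambda>Z. sum_mset G + l * (r + parts_above_1 G) + sum_mset Z)"
      by (simp add: gf_add_const gf_parts_ge_size power_add mult.assoc)
  qed
  finally show "gf {p \<in> ?S. size (snd p) = l} pair_sum = gf {M \<in> parts_ge 1. level r M = l} sum_mset"
    using gf_level[OF assms] by simp
qed

section \<open>Counting the colored partitions\<close>

definition admissible :: "nat \<Rightarrow> (nat multiset \<times> nat multiset \<times> nat multiset) set" where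
  "admissible r = (SIGMA G:gordon r.
     {(b, d). b \<in> parts_ge 1 \<and> d \<in> parts_ge 1 \<and> threshold (r + parts_above_1 G) b d})"

abbreviation triple_sum :: "nat multiset \<times> nat multiset \<times> nat multiset \<Rightarrow> nat" where
  "triple_sum \<equiv> \<lambda>(G, p). sum_mset G + pair_sum p"

text \<open>For each green partition \<open>G\<close>, a multiset of ones, an unrestricted partition and a partition \<open>B\<close> with parts
  at least \<open>r + parts_above_1 G\<close> replace the black and red parts. Then \<open>G\<close> and \<open>B\<close> are taken together.\<close>
lemma gf_admissible:
  assumes "r \<ge> 2"
  shows "gf (admissible r) triple_sum = gf ones sum_mset * E 1 * E 1"
proof -
  let ?S = "SIGMA G:gordon r. (ones \<times> parts_ge 1) \<times> parts_ge (r + parts_above_1 G)"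
  let ?w = "\<lambda>(G, p, B). sum_mset G + (pair_sum p + sum_mset B)"
  let ?T = "(ones \<times> parts_ge 1) \<times> (SIGMA G:gordon r. parts_ge (r + parts_above_1 G))"
  have fin_ge: "graded_finite (parts_ge m) sum_mset" if "m \<ge> 1" for m
    using that graded_finite_parts parts_ge_antimono by blast
  have fin_op: "graded_finite (ones \<times> parts_ge 1) pair_sum"
    by (rule graded_finite_pair) (use ones_subset in auto)
  have fin_gl: "graded_finite (SIGMA G:gordon r. parts_ge (r + parts_above_1 G)) pair_sum"
    by (rule graded_finite_pair) (use assms in \<open>auto simp: gordon_def parts_ge_def\<close>)
  have gordon: "gordon r \<subseteq> parts_ge 1" by (auto simp: gordon_def)
  have "gf (admissible r) triple_sum = gf ?S (\<lambda>(G, y). (\<lambda>(p, B). sum_mset G + (pair_sum p + sum_mset B)) y)"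
    unfolding admissible_def
  proof (rule gf_Sigma_cong)
    show "graded_finite (SIGMA G:gordon r. {(b, d). b \<in> parts_ge 1 \<and> d \<in> parts_ge 1 \<and>
        threshold (r + parts_above_1 G) b d}) triple_sum"
      by (rule graded_finite_subset[OF graded_finite_Times[OF graded_finite_parts_ge_1 graded_finite_pair[OF order_refl]]])
        (use gordon in auto)
    have "graded_finite (parts_ge 1 \<times> (ones \<times> parts_ge 1) \<times> parts_ge 1) (\<lambda>(G, y). sum_mset G + (\<lambda>(p, B). pair_sum p + sum_mset B) y)"
      by (intro graded_finite_Times graded_finite_parts_ge_1 fin_op)
    then show "graded_finite ?S (\<lambda>(G, y). (\<lambda>(p, B). sum_mset G + (pair_sum p + sum_mset B)) y)"
      by (rule graded_finite_mono) (use gordon assms in \<open>auto simp: parts_ge_def\<close>)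
    fix G
    let ?m = "r + parts_above_1 G"
    have "gf {(b, d). b \<in> parts_ge 1 \<and> d \<in> parts_ge 1 \<and> threshold ?m b d} pair_sum
        = gf ((ones \<times> parts_ge 1) \<times> parts_ge ?m) (\<lambda>(p, B). pair_sum p + sum_mset B)"
      using gf_threshold[of ?m] assms
        gf_Times[OF fin_op fin_ge[of ?m]]
        gf_Times[OF graded_finite_parts[OF ones_subset] graded_finite_parts_ge_1]
      by (simp del: One_nat_def)
    then have "gf {(b, d). b \<in> parts_ge 1 \<and> d \<in> parts_ge 1 \<and> threshold ?m b d} (\<lambda>p. sum_mset G + pair_sum p)
        = gf ((ones \<times> parts_ge 1) \<times> parts_ge ?m) (\<lambda>y. sum_mset G + (\<lambda>(p, B). pair_sum p + sum_mset B) y)"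
      by (simp only: gf_add_const)
    moreover have "(\<lambda>y. sum_mset G + (\<lambda>(p, B). pair_sum p + sum_mset B) y)
        = (\<lambda>(p, B). sum_mset G + (pair_sum p + sum_mset B))" by (simp add: fun_eq_iff)
    ultimately show "gf {(b, d). b \<in> parts_ge 1 \<and> d \<in> parts_ge 1 \<and> threshold ?m b d} (\<lambda>p. sum_mset G + pair_sum p)
        = gf ((ones \<times> parts_ge 1) \<times> parts_ge ?m) (\<lambda>(p, B). sum_mset G + (pair_sum p + sum_mset B))"
      by (simp only:)
  qed
  also have "\<dots> = gf ?T (\<lambda>(p, q). pair_sum p + pair_sum q)"
    by (rule gf_bij[symmetric, of "\<lambda>(G, p, B). (p, G, B)"])
      (auto simp: bij_betw_def inj_on_def image_iff)
  also have "\<dots> = gf ones sum_mset * E 1 * E 1"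
    using gf_Times[OF fin_op fin_gl] gf_gordon_large_parts[of r] assms
      gf_Times[OF graded_finite_parts[OF ones_subset] graded_finite_parts_ge_1]
    by (simp del: One_nat_def)
  finally show ?thesis .
qed

definition merge_colors :: "nat multiset \<times> nat multiset \<times> nat multiset \<Rightarrow> (nat \<times> color) multiset" where
  "merge_colors = (\<lambda>(G, b, d).
     image_mset (\<lambda>x. (x, Green)) G + image_mset (\<lambda>x. (x, Black)) b + image_mset (\<lambda>x. (x, Red)) d)"

lemma parts_of_color_merge:
  "parts_of_color Green (merge_colors (G, b, d)) = G"
  "parts_of_color Black (merge_colors (G, b, d)) = b"
  "parts_of_color Red (merge_colors (G, b, d)) = d"
  by (simp_all add: parts_of_color_def merge_colors_def filter_mset_image_mset multiset.map_comp comp_def)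

lemma merge_parts_of_color:
  "merge_colors (parts_of_color Green L, parts_of_color Black L, parts_of_color Red L) = L"
proof (induction L)
  case (add p L)
  then show ?case
    by (cases p; cases "snd p") (auto simp: parts_of_color_def merge_colors_def)
qed (simp add: parts_of_color_def merge_colors_def)

lemma bij_merge_colors: "bij merge_colors"
  by (rule bij_betw_byWitness[of _ "\<lambda>L. (parts_of_color Green L, parts_of_color Black L, parts_of_color Red L)"])
    (auto simp: parts_of_color_merge merge_parts_of_color)

lemma weight_merge: "weight (merge_colors p) = triple_sum p"
  by (cases p) (simp add: weight_def merge_colors_def multiset.map_comp comp_def)

lemma card_colored_by_merge:
  assumes "\<And>p. merge_colors p \<in> X \<longleftrightarrow> p \<in> A \<and> triple_sum p = n"
  shows "int (card X) = fps_nth (gf A triple_sum) n"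
proof -
  have "bij_betw merge_colors {p \<in> A. triple_sum p = n} X"
  proof -
    have "X = merge_colors ` {p \<in> A. triple_sum p = n}"
      using assms bij_is_surj[OF bij_merge_colors] by (force simp: image_iff surj_def)
    then show ?thesis
      using bij_is_inj[OF bij_merge_colors] inj_on_subset by (auto simp: bij_betw_def)
  qed
  then show ?thesis by (simp add: gf_nth bij_betw_same_card)
qed

lemma set_mset_merge: "set_mset (merge_colors (G, b, d)) = (\<lambda>x. (x, Green)) ` set_mset G \<union> (\<lambda>x. (x, Black)) ` set_mset b \<union> (\<lambda>x. (x, Red)) ` set_mset d"
  by (simp add: merge_colors_def)

lemma card_one_three_others_two:
  "int (card (one_three_others_two n)) = fps_nth (gf ones sum_mset * E 1 * E 1) n"
proof -
  have "int (card (one_three_others_two n)) = fps_nth (gf (ones \<times> parts_ge 1 \<times> parts_ge 1) triple_sum) n"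
  proof (rule card_colored_by_merge)
    fix p :: "nat multiset \<times> nat multiset \<times> nat multiset"
    obtain G b d where p: "p = (G, b, d)" by (cases p)
    show "merge_colors p \<in> one_three_others_two n \<longleftrightarrow> p \<in> ones \<times> parts_ge 1 \<times> parts_ge 1 \<and> triple_sum p = n"
      unfolding one_three_others_two_def colored_partitions_def mem_Collect_eq weight_merge
      by (auto simp: p set_mset_merge ball_Un ones_def parts_ge_def Suc_le_eq split: if_splits)
  qed
  then show ?thesis
    using gf_Times[OF graded_finite_parts[OF ones_subset] graded_finite_pair[OF order_refl]]
      gf_Times[OF graded_finite_parts_ge_1 graded_finite_parts_ge_1]
    by (simp del: One_nat_def add: mult.assoc)
qed

lemma le_nth_sorted_iff:
  fixes t :: nat
  assumes "sorted xs" "j < length xs"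
  shows "t \<le> xs ! j \<longleftrightarrow> length (filter (\<lambda>x. x < t) xs) \<le> j"
  using assms
proof (induction xs arbitrary: j)
  case (Cons x xs)
  show ?case
  proof (cases "x < t")
    case True
    then show ?thesis using Cons by (cases j) auto
  next
    case False
    then have "filter (\<lambda>x. x < t) (x # xs) = []" using Cons.prems(1) by (auto simp: filter_empty_conv)
    moreover have "t \<le> (x # xs) ! j"
      using False sorted_nth_mono[OF Cons.prems(1) le0 Cons.prems(2)] by simp
    ultimately show ?thesis by simp
  qed
qed simp

lemma size_filter_eq_length_sorted:
  "size (filter_mset P M) = length (filter P (sorted_list_of_multiset M))"
  by (metis mset_filter mset_sorted_list_of_multiset size_mset)

lemma le_kth_smallest_iff:
  fixes t :: nat
  assumes "1 \<le> k" "k \<le> size M"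
  shows "t \<le> sorted_list_of_multiset M ! (k - 1) \<longleftrightarrow> size (filter_mset (\<lambda>x. x < t) M) < k"
proof -
  have "length (sorted_list_of_multiset M) = size M"
    by (metis mset_sorted_list_of_multiset size_mset)
  then show ?thesis
    using assms le_nth_sorted_iff[of "sorted_list_of_multiset M" "k - 1" t]
    by (auto simp: size_filter_eq_length_sorted)
qed

text \<open>If there is no green part, then \<open>parts_above_1 G = 0\<close>, and the condition for three colors becomes the
  one for black and red. If there is no black or no red part, then the threshold is met trivially.\<close>
lemma F_cond_merge:
  assumes "b \<in> parts_ge 1" "d \<in> parts_ge 1"
  shows "F_cond r (merge_colors (G, b, d)) \<longleftrightarrow> threshold (r + parts_above_1 G) b d"
proof (cases "b = {#} \<or> d = {#}")
  case True
  have "threshold (r + parts_above_1 G) b d"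
  proof (cases "b = {#}")
    case False
    then have "0 < Min_mset b" using assms by (simp add: parts_ge_def Suc_le_eq)
    then show ?thesis
      using True False unfolding threshold_def by (simp only: filter_empty_mset size_empty simp_thms)
  qed (simp add: threshold_def)
  moreover have "F_cond r (merge_colors (G, b, d))"
  proof -
    have "colors (merge_colors (G, b, d)) = (if G = {#} then {} else {Green}) \<union>
        (if b = {#} then {} else {Black}) \<union> (if d = {#} then {} else {Red})"
      by (auto simp: colors_def set_mset_merge image_Un image_image)
    moreover have "merge_colors (G, b, d) = {#}" if "G = {#}" "b = {#}" "d = {#}"
      using that by (simp add: merge_colors_def)
    ultimately show ?thesis
      using True by (auto simp: F_cond_def Let_def)
  qed
  ultimately show ?thesis by simp
next
  case False
  define k where "k = Min_mset b"
  define i where "i = sorted_list_of_multiset d ! (k - 1)"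
  have k: "k \<ge> 1" using assms False by (simp add: parts_ge_def k_def)
  have stat: "smallest_black (merge_colors (G, b, d)) = k"
    "kth_smallest_red (merge_colors (G, b, d)) k = i"
    "num_parts Red (merge_colors (G, b, d)) = size d" "num_parts Green (merge_colors (G, b, d)) = size G"
    by (simp_all add: smallest_black_def kth_smallest_red_def num_parts_def parts_of_color_merge k_def i_def)
  have colors: "colors (merge_colors (G, b, d)) = (if G = {#} then {} else {Green}) \<union> {Black, Red}"
    using False by (auto simp: colors_def set_mset_merge image_Un image_image)
  have thr: "threshold m b d \<longleftrightarrow> size d < k \<or> (k \<le> size d \<and> m \<le> k + i)" for m
  proof (cases "size d < k")
    case True
    then show ?thesis using False
      by (auto simp: threshold_def k_def[symmetric] intro: le_less_trans[OF size_filter_mset_lesseq])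
  next
    case geq: False
    have "(\<lambda>x. x + k < m) = (\<lambda>x. x < m - k)" by auto
    moreover have "m - k \<le> i \<longleftrightarrow> size (filter_mset (\<lambda>x. x < m - k) d) < k"
      unfolding i_def using k geq by (intro le_kth_smallest_iff) auto
    ultimately show ?thesis using False geq by (auto simp: threshold_def k_def[symmetric])
  qed
  have ne: "merge_colors (G, b, d) \<noteq> {#}" using False by (simp add: merge_colors_def)
  have "F_cond r (merge_colors (G, b, d)) \<longleftrightarrow> size d < k \<or> (k \<le> size d \<and> r + parts_above_1 G \<le> k + i)"
  proof (cases "G = {#}")
    case True
    have "colors (merge_colors (G, b, d)) = {Black, Red}" unfolding colors using True by simp
    moreover have "parts_above_1 G = 0" using True by (simp add: parts_above_1_def)
    moreover have "size d \<le> k - 1 \<longleftrightarrow> size d < k" using k by auto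
    ultimately show ?thesis using ne unfolding F_cond_def Let_def stat by simp
  next
    case False
    then have "colors (merge_colors (G, b, d)) = {Black, Red, Green}" by (simp add: colors)
    then have card: "card (colors (merge_colors (G, b, d))) = 3"
      "colors (merge_colors (G, b, d)) \<noteq> {Black, Red}" by auto
    have "int (parts_above_1 G) = int (size G) - int (count G 1)"
      using count_le_size[of G 1] by (simp add: parts_above_1_def of_nat_diff)
    then have "int (size G) - int (count G 1) < int k + int i - int r + 1 \<longleftrightarrow> r + parts_above_1 G \<le> k + i"
      by linarith
    moreover have "size d \<le> k - 1 \<longleftrightarrow> size d < k" using k by auto
    ultimately show ?thesis
      using card ne unfolding F_cond_def Let_def stat parts_of_color_merge by auto
  qed
  then show ?thesis using thr by simp
qed

text \<open>In a sorted list the entries \<open>i\<close> and \<open>i + 1\<close> form one block. More than \<open>R\<close> such entries are the same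
  as two entries at distance \<open>R\<close> that differ by at most \<open>1\<close>.\<close>
lemma gap_condition_iff:
  fixes xs :: "nat list"
  assumes "sorted xs"
  shows "(\<forall>j. j + R < length xs \<longrightarrow> xs ! j + 2 \<le> xs ! (j + R)) \<longleftrightarrow>
    (\<forall>i. count (mset xs) i + count (mset xs) (Suc i) \<le> R)"
proof -
  let ?f = "\<lambda>t. length (filter (\<lambda>x. x < t) xs)"
  have "?f (i + 2) = ?f i + (count (mset xs) i + count (mset xs) (Suc i))" for i
    by (induction xs) auto
  note f = this
  show ?thesis
  proof (intro iffI allI impI)
    fix i assume gap: "\<forall>j. j + R < length xs \<longrightarrow> xs ! j + 2 \<le> xs ! (j + R)"
    show "count (mset xs) i + count (mset xs) (Suc i) \<le> R"
    proof (rule ccontr)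
      assume "\<not> ?thesis"
      then have less: "?f i + R < ?f (i + 2)" using f[of i] by simp
      then have len: "?f i + R < length xs" using length_filter_le order.strict_trans2 by blast
      then have "i \<le> xs ! ?f i" using le_nth_sorted_iff[OF assms, of "?f i" i] by simp
      moreover have "\<not> i + 2 \<le> xs ! (?f i + R)"
        using le_nth_sorted_iff[OF assms len, of "i + 2"] less by simp
      ultimately show False using gap len by fastforce
    qed
  next
    fix j assume cnt: "\<forall>i. count (mset xs) i + count (mset xs) (Suc i) \<le> R" and j: "j + R < length xs"
    have "?f (xs ! j) \<le> j" using le_nth_sorted_iff[OF assms, of j "xs ! j"] j by simp
    then have "?f (xs ! j + 2) \<le> j + R" using f[of "xs ! j"] cnt[rule_format, of "xs ! j"] by linarith
    then show "xs ! j + 2 \<le> xs ! (j + R)" using le_nth_sorted_iff[OF assms j] by blast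
  qed
qed

lemma B_rr_iff_gordon:
  assumes "r \<ge> 1"
  shows "(\<exists>m. rev (sorted_list_of_multiset G) \<in> B_rr r m) \<longleftrightarrow> G \<in> gordon r"
proof -
  define xs where "xs = sorted_list_of_multiset G"
  have xs: "sorted xs" "mset xs = G" by (simp_all add: xs_def)
  have set: "set xs = set_mset G" using xs(2) by auto
  have rev: "(\<forall>j. j + R < length xs \<longrightarrow> rev xs ! j \<ge> rev xs ! (j + R) + 2) \<longleftrightarrow>
      (\<forall>j. j + R < length xs \<longrightarrow> xs ! j + 2 \<le> xs ! (j + R))" (is "?A \<longleftrightarrow> ?B") for R
  proof -
    have eq: "rev xs ! j = xs ! (length xs - Suc (j + R) + R)" "rev xs ! (j + R) = xs ! (length xs - Suc (j + R))"
      if "j + R < length xs" for j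
      using that by (auto simp: rev_nth intro!: arg_cong[of _ _ "(!) xs"])
    show ?thesis
    proof
      assume A: ?A
      show ?B
      proof (intro allI impI)
        fix j assume j: "j + R < length xs"
        let ?i = "length xs - Suc (j + R)"
        have "?i + R < length xs" "length xs - Suc (?i + R) = j" using j by auto
        then show "xs ! j + 2 \<le> xs ! (j + R)" using A[rule_format, of ?i] eq[of ?i] by simp
      qed
    next
      assume B: ?B
      show ?A
      proof (intro allI impI)
        fix j assume j: "j + R < length xs"
        then have "length xs - Suc (j + R) + R < length xs" by simp
        then show "rev xs ! j \<ge> rev xs ! (j + R) + 2" using B eq[OF j] by metis
      qed
    qed
  qed
  have gap: "(\<forall>j. j + (r - 1) < length (rev xs) \<longrightarrow> rev xs ! j \<ge> rev xs ! (j + (r - 1)) + 2) \<longleftrightarrow>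
      (\<forall>i. count G i + count G (Suc i) \<le> r - 1)"
    by (simp only: length_rev rev gap_condition_iff[OF xs(1)] xs(2))
  have ones: "count_list (rev xs) 1 = count G 1" using xs(2) by (auto simp: count_mset)
  have "sorted_wrt (\<ge>) (rev xs)" using xs(1) by (simp add: sorted_wrt_rev)
  then have "(\<exists>m. rev xs \<in> B_rr r m) \<longleftrightarrow> G \<in> parts_ge 1 \<and>
     (\<forall>i. count G i + count G (Suc i) \<le> r - 1) \<and> count G 1 \<le> r - 1"
    unfolding B_rr_def mem_Collect_eq gap ones by (simp add: parts_ge_def set Suc_le_eq)
  moreover have "count G 1 \<le> r - 1" if "\<forall>i. count G i + count G (Suc i) \<le> r - 1"
    using that[rule_format, of 0] by simp
  moreover have "x \<le> r - 1 \<longleftrightarrow> x < r" for x using assms by auto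
  ultimately show ?thesis unfolding xs_def gordon_def by auto
qed

lemma F_eq_coefficient:
  assumes "r \<ge> 2"
  shows "int (F r n) = fps_nth (gf (admissible r) triple_sum) n"
  unfolding F_def
proof (rule card_colored_by_merge)
  fix p :: "nat multiset \<times> nat multiset \<times> nat multiset"
  obtain G b d where p: "p = (G, b, d)" by (cases p)
  have "merge_colors p \<in> three_colored_partitions n \<longleftrightarrow>
      G \<in> parts_ge 1 \<and> b \<in> parts_ge 1 \<and> d \<in> parts_ge 1 \<and> triple_sum p = n"
    unfolding three_colored_partitions_def colored_partitions_def mem_Collect_eq weight_merge
    by (auto simp: p set_mset_merge ball_Un parts_ge_def Suc_le_eq)
  then show "merge_colors p \<in> F_set r n \<longleftrightarrow> p \<in> admissible r \<and> triple_sum p = n"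
    using assms B_rr_iff_gordon[of r G] F_cond_merge[of b d r G]
    by (auto simp: F_set_def p parts_of_color_merge admissible_def gordon_def)
qed

theorem theorem2:
  fixes n :: nat
  shows "(\<forall>r\<ge>2. \<forall>s\<ge>2. F r n = F s n) \<and>
         (\<forall>r\<ge>2. F r n = card (one_three_others_two n))"
proof -
  have "F r n = card (one_three_others_two n)" if "r \<ge> 2" for r
    using F_eq_coefficient[OF that, of n] gf_admissible[OF that] card_one_three_others_two[of n] by simp
  then show ?thesis by simp
qed

end
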